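(* Let $r=O(1)$ be a constant. Let $(\mathit{Init},\delta,\mathit{Bad})$ be a transition system over $n$ Boolean variables and $k\in\mathbb{N}$. If there exists an inductive invariant $I$ that is forwards $k$-fenced, and $I$ is an $r$-almost-(anti)monotone CNF formula with $m$ clauses, then the dual algorithm $\Lambda$-Inference$^{*}(\mathit{Init},\delta,\mathit{Bad},k)$ with an appropriate basis (namely, the set of all translations that assign $\mathit{true}$ to at most $r$ variables) converges to an inductive invariant in $\mathrm{poly}(m\cdot n)$ inductiveness checks, $\mathrm{poly}(m\cdot n)$ $k$-BMC checks, and $\mathrm{poly}(m\cdot n)$ time.
   Context: Transition systems. $\Sigma=\{p_1,\dots,p_n\}$ is a finite set of Boolean variables; a state is a valuation $x$ of $\Sigma$, $x[p]$ is its value at $p$, and $x[p\mapsto z]$ is $x$ with $p$ reassigned to $z$; a formula over $\Sigma$ is identified with the set of states satisfying it, and $\varphi\Longrightarrow\psi$ means that $\varphi\to\psi$ is valid. A transition system is a triple $(\mathit{Init},\delta,\mathit{Bad})$ with $\mathit{Init},\mathit{Bad}$ formulas over $\Sigma$ and $\delta$ a formula over $\Sigma\uplus\Sigma'$ ($\Sigma'$ a primed copy), describing pairs (pre-state, post-state). Standing assumptions: $\mathit{Init}\not\equiv\mathit{false}$, $\mathit{Bad}\not\equiv\mathit{true},\mathit{false}$, $\mathit{Init}\Longrightarrow\neg\mathit{Bad}$. An inductive invariant is a formula $I$ over $\Sigma$ with (i) $\mathit{Init}\Longrightarrow I$, (ii) $I\wedge\delta\Longrightarrow I'$, (iii) $I\Longrightarrow\neg\mathit{Bad}$,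 where $I'$ is $I$ with variables primed. Bounded reachability. $\delta^{\le k}(S)$ is the set of states reachable from some state in $S$ in at most $k$ steps of $\delta$. Fence condition. Two states are neighbors if they differ in exactly one variable. $\partial^+(I)=\{\sigma\models I : \sigma\text{ has a neighbor }\not\models I\}$. An inductive invariant $I$ is forwards $k$-fenced if $\partial^+(I)\subseteq\delta^{\le k}(\mathit{Init})$. A CNF formula (conjunction of clauses, i.e. of disjunctions of literals) is $r$-almost-(anti)monotone if at most $r$ of its clauses include positive literals. A translation is a valuation $a$ of $\Sigma$. The monotone cube of a state $v$ w.r.t. $a$, $\mathrm{cube}_a(v)$, is the conjunction of the literals over those $p_i$ with $v[p_i]\ne a[p_i]$ that hold in $v$. Algorithm $\Lambda$-Inference$(\mathit{Init},\delta,\mathit{Bad},k)$ with given translations $a_1,\dots,a_t$ (the "basis"): set $H_1,\dots,H_t\leftarrow\mathit{false}$. While $H=\bigwedge_{i=1}^t H_i$ is not an inductive invariant: take any state $\sigma'$ such that either $(\sigma,\sigma')\models H\wedge\delta\wedge\neg H'$ for some $\sigma$, or $\sigma'\models\mathit{Init}\wedge\neg H$; for each $i=1,\dots,t$ with $\sigma'\not\models H_i$, set $H_i\leftarrow H_i\vee d$ where $d=\mathrm{MonGenBmc}(\sigma',a_i)$. Return $\bigwedge_i H_i$. Procedure $\mathrm{MonGenBmc}(\sigma,a)$: if $\delta^{\le k}(\{\sigma\})\cap\mathit{Bad}\ne\emptyset$, the run with bound $k$ fails (restart with larger $k$). Otherwise let $v\leftarrow\sigma$ and repeat passes until a pass makes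 no change: in a pass, for $j=1,\dots,n$ with $a[p_j]\ne v[p_j]$, let $x=v[p_j\mapsto a[p_j]]$ and if $\delta^{\le k}(\{x\})\cap\mathit{Bad}=\emptyset$ set $v\leftarrow x$. Return $\mathrm{cube}_a(v)$. Dual algorithm. $\Lambda$-Inference$^{*}(\mathit{Init},\delta,\mathit{Bad},k)=\neg\,\Lambda$-Inference$(\mathit{Bad},\delta^{-1},\mathit{Init},k)$: run $\Lambda$-Inference on the dual system $(\mathit{Bad},\delta^{-1},\mathit{Init})$, where $\delta^{-1}=\delta(\Sigma',\Sigma)$, and negate the result. "Converges to an inductive invariant" means that, for every resolution of the arbitrary choices, it terminates without failing with bound $k$ and returns an inductive invariant for $(\mathit{Init},\delta,\mathit{Bad})$. Complexity measure. An inductiveness check decides whether a candidate is an inductive invariant and returns a counterexample if not; a $k$-BMC check decides whether $\delta^{\le k}(\psi)\cap\mathit{Bad}=\emptyset$ or whether $\delta^{\le k}(\mathit{Init})\cap\psi=\emptyset$ for a given $\psi$. Time counts each such check (SAT oracle call) as one step. $\mathrm{poly}(m\cdot n)$ means bounded by a polynomial in $m\cdot n$, which may depend on the constant $r$. *)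

theory Defs
  imports
    "HOL-Library.Product_Plus"
    "HOL-Computational_Algebra.Polynomial"
begin

section \<open>States, formulas and transition systems\<close>

text \<open>The variables are \<open>p\<^sub>0, \<dots>, p\<^sub>n\<^sub>-\<^sub>1\<close>. The number of variables is a parameter and not a type, since
  complexity bounds are uniform in it. A formula is identified with its set of models, and the
  transition formula with its set of pairs (pre-state, post-state).\<close>

type_synonym state = "bool list"

definition states :: "nat \<Rightarrow> state set" where
  "states n = {v. length v = n}"

definition transition_system ::
  "nat \<Rightarrow> state set \<Rightarrow> (state \<times> state) set \<Rightarrow> state set \<Rightarrow> bool" where
  "transition_system n Init \<delta> Bad \<longleftrightarrow>
     Init \<subseteq> states n \<and> \<delta> \<subseteq> states n \<times> states n \<and> Bad \<subseteq> states n \<and>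
     Init \<noteq> {} \<and> Bad \<noteq> {} \<and> Bad \<noteq> states n \<and> Init \<subseteq> states n - Bad"

definition inductive_invariant ::
  "nat \<Rightarrow> state set \<Rightarrow> (state \<times> state) set \<Rightarrow> state set \<Rightarrow> state set \<Rightarrow> bool" where
  "inductive_invariant n Init \<delta> Bad I \<longleftrightarrow>
     I \<subseteq> states n \<and> Init \<subseteq> I \<and> (\<forall>(\<sigma>, \<sigma>') \<in> \<delta>. \<sigma> \<in> I \<longrightarrow> \<sigma>' \<in> I) \<and> I \<subseteq> states n - Bad"

definition reach_le :: "(state \<times> state) set \<Rightarrow> nat \<Rightarrow> state set \<Rightarrow> state set" where
  "reach_le \<delta> k S = (\<Union>i\<le>k. (\<delta> ^^ i) `` S)"

definition neighbors :: "nat \<Rightarrow> state \<Rightarrow> state \<Rightarrow> bool" where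
  "neighbors n \<sigma> \<tau> \<longleftrightarrow> \<sigma> \<in> states n \<and> \<tau> \<in> states n \<and> (\<exists>!j. j < n \<and> \<sigma> ! j \<noteq> \<tau> ! j)"

definition inner_boundary :: "nat \<Rightarrow> state set \<Rightarrow> state set" where
  "inner_boundary n I = {\<sigma> \<in> I. \<exists>\<tau>. neighbors n \<sigma> \<tau> \<and> \<tau> \<notin> I}"

definition forwards_fenced ::
  "nat \<Rightarrow> state set \<Rightarrow> (state \<times> state) set \<Rightarrow> nat \<Rightarrow> state set \<Rightarrow> bool" where
  "forwards_fenced n Init \<delta> k I \<longleftrightarrow> inner_boundary n I \<subseteq> reach_le \<delta> k Init"


section \<open>Normal forms\<close>

text \<open>\<open>(j, True)\<close> is the literal \<open>p\<^sub>j\<close>, and \<open>(j, False)\<close> is its negation.\<close>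

type_synonym literal = "nat \<times> bool"
type_synonym clause = "literal list"
type_synonym cnf = "clause list"
type_synonym cube = "literal list"
type_synonym dnf = "cube list"

definition sat_lit :: "state \<Rightarrow> literal \<Rightarrow> bool" where
  "sat_lit \<sigma> l \<longleftrightarrow> \<sigma> ! fst l = snd l"

definition sat_cnf :: "state \<Rightarrow> cnf \<Rightarrow> bool" where
  "sat_cnf \<sigma> F \<longleftrightarrow> (\<forall>c \<in> set F. \<exists>l \<in> set c. sat_lit \<sigma> l)"

definition sat_dnf :: "state \<Rightarrow> dnf \<Rightarrow> bool" where
  "sat_dnf \<sigma> D \<longleftrightarrow> (\<exists>c \<in> set D. \<forall>l \<in> set c. sat_lit \<sigma> l)"

definition cnf_over :: "nat \<Rightarrow> cnf \<Rightarrow> bool" where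
  "cnf_over n F \<longleftrightarrow> (\<forall>c \<in> set F. \<forall>l \<in> set c. fst l < n)"

definition cnf_models :: "nat \<Rightarrow> cnf \<Rightarrow> state set" where
  "cnf_models n F = {\<sigma> \<in> states n. sat_cnf \<sigma> F}"

definition almost_antimonotone :: "nat \<Rightarrow> cnf \<Rightarrow> bool" where
  "almost_antimonotone r F \<longleftrightarrow> length (filter (\<lambda>c. \<exists>l \<in> set c. snd l) F) \<le> r"

definition mono_cube :: "state \<Rightarrow> state \<Rightarrow> cube" where
  "mono_cube a v = map (\<lambda>i. (i, v ! i)) (filter (\<lambda>i. v ! i \<noteq> a ! i) [0..<length v])"

definition sparse_translations :: "nat \<Rightarrow> nat \<Rightarrow> state set" where
  "sparse_translations n r = {a \<in> states n. card {j. j < n \<and> a ! j} \<le> r}"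


section \<open>Cost model\<close>

text \<open>A cost is a triple (inductiveness checks, \<open>k\<close>-BMC checks, time), added componentwise. Every
  check is one time step; beyond the checks, time also counts the elementary operations on single
  bits, literals and list cells.\<close>

type_synonym cost = "nat \<times> nat \<times> nat"

definition ind_check :: cost where "ind_check = (1, 0, 1)"
definition bmc_check :: cost where "bmc_check = (0, 1, 1)"
definition ops :: "nat \<Rightarrow> cost" where "ops i = (0, 0, i)"

definition ind_checks :: "cost \<Rightarrow> nat" where "ind_checks c = fst c"
definition bmc_checks :: "cost \<Rightarrow> nat" where "bmc_checks c = fst (snd c)"
definition time :: "cost \<Rightarrow> nat" where "time c = snd (snd c)"

definition dnf_size :: "dnf \<Rightarrow> nat" where
  "dnf_size D = 1 + (\<Sum>c\<leftarrow>D. 1 + length c)"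


section \<open>Generalization\<close>

definition bmc_safe :: "(state \<times> state) set \<Rightarrow> nat \<Rightarrow> state set \<Rightarrow> state \<Rightarrow> bool" where
  "bmc_safe \<delta> k Bad x \<longleftrightarrow> reach_le \<delta> k {x} \<inter> Bad = {}"

text \<open>In what follows \<open>safe\<close> stands for the BMC oracle \<open>bmc_safe \<delta> k Bad\<close>; each of its
  evaluations is charged as one \<open>bmc_check\<close>.\<close>

fun gen_pass :: "(state \<Rightarrow> bool) \<Rightarrow> state \<Rightarrow> nat list \<Rightarrow> state \<Rightarrow> state \<times> cost" where
  "gen_pass safe a [] v = (v, 0)"
| "gen_pass safe a (j # js) v =
     (if a ! j \<noteq> v ! j then
        let x = v[j := a ! j];
            (w, c) = gen_pass safe a js (if safe x then x else v)
        in (w, ops 3 + bmc_check + c)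
      else
        let (w, c) = gen_pass safe a js v in (w, ops 1 + c))"

definition hamming :: "state \<Rightarrow> state \<Rightarrow> nat" where
  "hamming a v = card {j. j < length v \<and> a ! j \<noteq> v ! j}"

lemma hamming_update:
  assumes "j < length v" "a ! j \<noteq> v ! j"
  shows "hamming a (v[j := a ! j]) < hamming a v"
  unfolding hamming_def using assms
  by (intro psubset_card_mono) (auto simp: nth_list_update split: if_splits)

lemma gen_pass_decreases:
  "gen_pass safe a js v = (w, c) \<Longrightarrow> \<forall>j \<in> set js. j < length v \<Longrightarrow>
     w = v \<or> hamming a w < hamming a v"
proof (induction js arbitrary: v w c)
  case (Cons j js)
  show ?case
  proof (cases "a ! j \<noteq> v ! j \<and> safe (v[j := a ! j])")
    case True
    then obtain c' where "gen_pass safe a js (v[j := a ! j]) = (w, c')"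
      using Cons.prems(1) by (auto simp: Let_def split: prod.splits)
    from Cons.IH[OF this] hamming_update[of j v a] True Cons.prems(2) show ?thesis by fastforce
  next
    case False
    then obtain c' where "gen_pass safe a js v = (w, c')"
      using Cons.prems(1) by (auto simp: Let_def split: prod.splits if_splits)
    from Cons.IH[OF this] Cons.prems(2) show ?thesis by simp
  qed
qed simp

text \<open>A pass makes no change iff it returns its input, because every change moves one bit
  towards \<open>a\<close> and no bit is moved back.\<close>

function gen_loop :: "(state \<Rightarrow> bool) \<Rightarrow> state \<Rightarrow> state \<Rightarrow> state \<times> cost" where
  "gen_loop safe a v =
     (let (w, c) = gen_pass safe a [0..<length v] v in
      if w = v then (v, ops (1 + length v) + c)
      else let (u, c') = gen_loop safe a w in (u, ops (1 + length v) + c + c'))"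
  by pat_completeness auto
termination
proof (relation "measure (\<lambda>(safe, a, v). hamming a v)", goal_cases)
  case (2 safe a v p w c)
  then show ?case using gen_pass_decreases[of safe a "[0..<length v]" v w c] by auto
qed simp

declare gen_loop.simps [simp del]

text \<open>\<open>None\<close> means that the run with the given bound fails.\<close>

definition mon_gen_bmc :: "(state \<Rightarrow> bool) \<Rightarrow> state \<Rightarrow> state \<Rightarrow> cube option \<times> cost" where
  "mon_gen_bmc safe \<sigma> a =
     (if \<not> safe \<sigma> then (None, bmc_check)
      else let (v, c) = gen_loop safe a \<sigma>
           in (Some (mono_cube a v), bmc_check + ops (length \<sigma>) + c + ops (length v)))"


section \<open>The inference algorithm and its dual\<close>

text \<open>The list of pairs holds, for each \<open>i\<close>, the translation \<open>a\<^sub>i\<close> and the current \<open>H\<^sub>i\<close>; the empty DNF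
  is \<open>false\<close>.\<close>

fun update :: "(state \<Rightarrow> bool) \<Rightarrow> state \<Rightarrow> (state \<times> dnf) list \<Rightarrow> dnf list option \<times> cost" where
  "update safe \<sigma> [] = (Some [], 0)"
| "update safe \<sigma> ((a, D) # ps) =
     (if sat_dnf \<sigma> D then
        let (res, c) = update safe \<sigma> ps
        in (map_option ((#) D) res, ops (dnf_size D) + c)
      else
        (case mon_gen_bmc safe \<sigma> a of
           (None, c) \<Rightarrow> (None, ops (dnf_size D) + c)
         | (Some d, c) \<Rightarrow>
             let (res, c') = update safe \<sigma> ps
             in (map_option ((#) (d # D)) res, ops (dnf_size D) + c + ops 1 + c')))"

definition conj_models :: "nat \<Rightarrow> dnf list \<Rightarrow> state set" where
  "conj_models n Hs = {\<sigma> \<in> states n. \<forall>D \<in> set Hs. sat_dnf \<sigma> D}"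

definition counterexample ::
  "state set \<Rightarrow> (state \<times> state) set \<Rightarrow> state set \<Rightarrow> state \<Rightarrow> bool" where
  "counterexample Init \<delta> H \<sigma>' \<longleftrightarrow>
     (\<exists>\<sigma>. \<sigma> \<in> H \<and> (\<sigma>, \<sigma>') \<in> \<delta> \<and> \<sigma>' \<notin> H) \<or> (\<sigma>' \<in> Init \<and> \<sigma>' \<notin> H)"

datatype config = Running "dnf list" cost | Failed cost | Returned "dnf list" cost

fun cost_of :: "config \<Rightarrow> cost" where
  "cost_of (Running Hs c) = c"
| "cost_of (Failed c) = c"
| "cost_of (Returned Hs c) = c"

text \<open>One transition is one evaluation of the loop condition, followed by the loop body or by the
  return. The only nondeterminism is the choice of \<open>\<sigma>'\<close>. A running configuration whose candidate is
  not an inductive invariant but for which there is no \<open>\<sigma>'\<close> to take is stuck.\<close>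

inductive lambda_step ::
  "nat \<Rightarrow> state set \<Rightarrow> (state \<times> state) set \<Rightarrow> state set \<Rightarrow> nat \<Rightarrow> state list \<Rightarrow>
   config \<Rightarrow> config \<Rightarrow> bool"
  for n Init \<delta> Bad k ts where
  return:
    "inductive_invariant n Init \<delta> Bad (conj_models n Hs) \<Longrightarrow>
     lambda_step n Init \<delta> Bad k ts (Running Hs c)
       (Returned Hs (c + ind_check + ops (\<Sum>D\<leftarrow>Hs. dnf_size D)))"
| refine:
    "\<not> inductive_invariant n Init \<delta> Bad (conj_models n Hs) \<Longrightarrow>
     counterexample Init \<delta> (conj_models n Hs) \<sigma>' \<Longrightarrow>
     update (bmc_safe \<delta> k Bad) \<sigma>' (zip ts Hs) = (Some Hs', c') \<Longrightarrow>
     lambda_step n Init \<delta> Bad k ts (Running Hs c) (Running Hs' (c + ind_check + c'))"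
| fail:
    "\<not> inductive_invariant n Init \<delta> Bad (conj_models n Hs) \<Longrightarrow>
     counterexample Init \<delta> (conj_models n Hs) \<sigma>' \<Longrightarrow>
     update (bmc_safe \<delta> k Bad) \<sigma>' (zip ts Hs) = (None, c') \<Longrightarrow>
     lambda_step n Init \<delta> Bad k ts (Running Hs c) (Failed (c + ind_check + c'))"

text \<open>The initial cost covers writing down the basis and setting each \<open>H\<^sub>i\<close> to \<open>false\<close>.\<close>

definition lambda_start :: "state list \<Rightarrow> config" where
  "lambda_start ts = Running (replicate (length ts) []) (ops (\<Sum>a\<leftarrow>ts. 1 + length a))"

definition dual_step ::
  "nat \<Rightarrow> state set \<Rightarrow> (state \<times> state) set \<Rightarrow> state set \<Rightarrow> nat \<Rightarrow> state list \<Rightarrow>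
   config \<Rightarrow> config \<Rightarrow> bool" where
  "dual_step n Init \<delta> Bad k ts = lambda_step n Bad (\<delta>\<inverse>) Init k ts"

definition dual_result :: "nat \<Rightarrow> dnf list \<Rightarrow> state set" where
  "dual_result n Hs = states n - conj_models n Hs"

definition dual_converges ::
  "nat \<Rightarrow> state set \<Rightarrow> (state \<times> state) set \<Rightarrow> state set \<Rightarrow> nat \<Rightarrow> state list \<Rightarrow> bool" where
  "dual_converges n Init \<delta> Bad k ts \<longleftrightarrow>
     (\<nexists>run. run 0 = lambda_start ts \<and>
        (\<forall>i::nat. dual_step n Init \<delta> Bad k ts (run i) (run (Suc i)))) \<and>
     (\<forall>conf. (dual_step n Init \<delta> Bad k ts)\<^sup>*\<^sup>* (lambda_start ts) conf \<and>
        (\<nexists>conf'. dual_step n Init \<delta> Bad k ts conf conf') \<longrightarrow>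
        (\<exists>Hs c. conf = Returned Hs c \<and> inductive_invariant n Init \<delta> Bad (dual_result n Hs)))"

end

theory Submission
  imports Defs
begin

text \<open>Let \<open>J = \<not>I\<close>, an inductive invariant of the dual system and a DNF with \<open>m\<close> terms. The fence condition
  says that every neighbor of \<open>J\<close> outside \<open>J\<close> is rejected by the BMC oracle, while states in \<open>J\<close> are always
  accepted; so generalization from a state in \<open>J\<close> stays in \<open>J\<close> and ends in a point which is
  minimal in \<open>J\<close> in the order centred at the translation. Such a point agrees with the translation outside the
  variables of some term it satisfies, hence there are at most \<open>m\<close> of them, and every refinement adds
  a new one to some \<open>H\<^sub>i\<close>. Conversely, the intersection of the monotone hulls of \<open>J\<close> over the basis is \<open>J\<close>: given
  \<open>x \<in> I\<close>, let the translation pick one true variable of \<open>x\<close> from each clause that \<open>x\<close> satisfies by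
  a positive literal. Thus \<open>H \<subseteq> J\<close> throughout, so that all counterexamples lie in \<open>J\<close>.\<close>

section \<open>Generalization\<close>

lemma ind_checks_simps [simp]:
  "ind_checks (c + d) = ind_checks c + ind_checks d" "ind_checks 0 = 0"
  "ind_checks ind_check = 1" "ind_checks bmc_check = 0" "ind_checks (ops i) = 0"
  by (simp_all add: ind_checks_def ind_check_def bmc_check_def ops_def)

lemma bmc_checks_simps [simp]:
  "bmc_checks (c + d) = bmc_checks c + bmc_checks d" "bmc_checks 0 = 0"
  "bmc_checks ind_check = 0" "bmc_checks bmc_check = 1" "bmc_checks (ops i) = 0"
  by (simp_all add: bmc_checks_def ind_check_def bmc_check_def ops_def)

lemma time_simps [simp]:
  "time (c + d) = time c + time d" "time 0 = 0"
  "time ind_check = 1" "time bmc_check = 1" "time (ops i) = i"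
  by (simp_all add: time_def ind_check_def bmc_check_def ops_def)

text \<open>\<open>v \<le>\<^sub>a x\<close> in the order in which moving a bit towards \<open>a\<close> is going down.\<close>

definition below :: "state \<Rightarrow> state \<Rightarrow> state \<Rightarrow> bool" where
  "below a v x \<longleftrightarrow> length v = length x \<and> (\<forall>i < length v. v ! i \<noteq> a ! i \<longrightarrow> v ! i = x ! i)"

lemma below_refl: "below a v v"
  by (simp add: below_def)

lemma below_trans: "below a u v \<Longrightarrow> below a v x \<Longrightarrow> below a u x"
  by (auto simp: below_def)

lemma below_update: "below a (v[j := a ! j]) v"
  unfolding below_def by (metis length_list_update nth_list_update_eq nth_list_update_neq)

text \<open>The cube fixes exactly the bits on which \<open>v\<close> departs from \<open>a\<close>,
  so its models are the states above \<open>v\<close> in the order centred at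
  \<open>a\<close>.\<close>

lemma sat_mono_cube:
  assumes "length v = length x"
  shows "(\<forall>l \<in> set (mono_cube a v). sat_lit x l) \<longleftrightarrow> below a v x"
  using assms by (auto simp: mono_cube_def below_def sat_lit_def)

lemma length_mono_cube: "length (mono_cube a v) \<le> length v"
  unfolding mono_cube_def by (metis length_filter_le length_map length_upt minus_nat.diff_0)

text \<open>Minimality is local: only single-bit moves towards \<open>a\<close> are tested. A pass
  without change certifies just this, and the counting of minimal points uses no more.\<close>

definition minimal_in :: "state set \<Rightarrow> state \<Rightarrow> state \<Rightarrow> bool" where
  "minimal_in J a v \<longleftrightarrow> v \<in> J \<and> (\<forall>j < length v. v ! j \<noteq> a ! j \<longrightarrow> v[j := a ! j] \<notin> J)"

lemma hamming_le: "hamming a v \<le> length v"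
  unfolding hamming_def
  by (metis (no_types, lifting) card_lessThan card_mono finite_lessThan lessThan_iff mem_Collect_eq subsetI)

section \<open>Passes and loop of the generalization\<close>

text \<open>The factor 4 is three operations plus one oracle call, itself a time step.\<close>

lemma gen_pass_cost:
  "gen_pass safe a js v = (w, c) \<Longrightarrow>
     ind_checks c = 0 \<and> bmc_checks c \<le> length js \<and> time c \<le> 4 * length js"
proof (induction js arbitrary: v c)
  case (Cons j js)
  show ?case
  proof (cases "a ! j \<noteq> v ! j")
    case True
    obtain w' c' where e: "gen_pass safe a js (if safe (v[j := a ! j]) then v[j := a ! j] else v) = (w', c')"
      by (metis surj_pair)
    then have "w = w'" "c = ops 3 + bmc_check + c'"
      using Cons.prems unfolding gen_pass.simps Let_def
      by (simp_all only: True e simp_thms if_True prod.case prod.inject)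
    with e Cons.IH show ?thesis by fastforce
  next
    case False
    then obtain c' where "gen_pass safe a js v = (w, c')" and "c = ops 1 + c'"
      using Cons.prems by (auto simp: Let_def split: prod.splits)
    with Cons.IH show ?thesis by fastforce
  qed
qed auto

lemma gen_pass_below:
  "gen_pass safe a js v = (w, c) \<Longrightarrow> below a w v"
proof (induction js arbitrary: v c)
  case (Cons j js)
  show ?case
  proof (cases "a ! j \<noteq> v ! j \<and> safe (v[j := a ! j])")
    case True
    then obtain c' where "gen_pass safe a js (v[j := a ! j]) = (w, c')"
      using Cons.prems by (auto simp: Let_def split: prod.splits)
    from Cons.IH[OF this] show ?thesis using below_update below_trans by blast
  next
    case False
    then obtain c' where "gen_pass safe a js v = (w, c')"
      using Cons.prems by (auto simp: Let_def split: prod.splits if_splits)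
    from Cons.IH[OF this] show ?thesis .
  qed
qed (simp add: below_refl)

lemma gen_pass_fixed:
  "gen_pass safe a js v = (v, c) \<Longrightarrow> \<forall>j \<in> set js. j < length v \<Longrightarrow>
     j \<in> set js \<Longrightarrow> a ! j \<noteq> v ! j \<Longrightarrow> \<not> safe (v[j := a ! j])"
proof (induction js arbitrary: c)
  case (Cons i js)
  show ?case
  proof (cases "a ! i \<noteq> v ! i \<and> safe (v[i := a ! i])")
    case True
    then obtain c' where "gen_pass safe a js (v[i := a ! i]) = (v, c')"
      using Cons.prems(1) by (auto simp: Let_def split: prod.splits)
    \<comment> \<open>An accepted flip strictly lowers the distance to \<open>a\<close> and later
      positions never raise it, so the pass could not end in \<open>v\<close>.\<close>
    from gen_pass_decreases[OF this] have False
      using hamming_update[of i v a] True Cons.prems(2) by (auto simp: list_update_same_conv)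
    then show ?thesis ..
  next
    case False
    then obtain c' where "gen_pass safe a js v = (v, c')"
      using Cons.prems(1) by (auto simp: Let_def split: prod.splits if_splits)
    from Cons.IH[OF this] Cons.prems False show ?thesis by auto
  qed
qed simp

text \<open>The assumption is the fence condition as seen by the algorithm: an accepted one-bit
  change cannot leave \<open>J\<close>.\<close>

lemma gen_pass_closed:
  assumes "\<And>v j b. v \<in> J \<Longrightarrow> j \<in> set js \<Longrightarrow> safe (v[j := b]) \<Longrightarrow> v[j := b] \<in> J"
  shows "gen_pass safe a js v = (w, c) \<Longrightarrow> v \<in> J \<Longrightarrow> w \<in> J"
  using assms
proof (induction js arbitrary: v c)
  case (Cons j js)
  show ?case
  proof (cases "a ! j \<noteq> v ! j \<and> safe (v[j := a ! j])")
    case True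
    then obtain c' where "gen_pass safe a js (v[j := a ! j]) = (w, c')"
      using Cons.prems(1) by (auto simp: Let_def split: prod.splits)
    from Cons.IH[OF this] True Cons.prems(2,3) show ?thesis by simp
  next
    case False
    then obtain c' where "gen_pass safe a js v = (w, c')"
      using Cons.prems(1) by (auto simp: Let_def split: prod.splits if_splits)
    from Cons.IH[OF this] Cons.prems(2,3) show ?thesis by simp
  qed
qed simp

text \<open>Every pass but the last lowers the Hamming distance, whence
  \<open>hamming a v + 1\<close> passes. To the cost of a pass, \<open>1 + length v\<close> is added
  for comparing its input and output.\<close>

lemma gen_loop_cost:
  "gen_loop safe a v = (u, c) \<Longrightarrow>
     ind_checks c = 0 \<and> bmc_checks c \<le> (hamming a v + 1) * length v \<and>
     time c \<le> (hamming a v + 1) * (1 + 5 * length v)"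
proof (induction "hamming a v" arbitrary: v u c rule: less_induct)
  case less
  obtain w c1 where p: "gen_pass safe a [0..<length v] v = (w, c1)" by (metis surj_pair)
  note c1 = gen_pass_cost[OF p]
  show ?case
  proof (cases "w = v")
    case True
    then have "c = ops (1 + length v) + c1"
      using less.prems p by (subst (asm) gen_loop.simps) auto
    with c1 show ?thesis by simp
  next
    case False
    then obtain c2 where l: "gen_loop safe a w = (u, c2)" and c: "c = ops (1 + length v) + c1 + c2"
      using less.prems p by (subst (asm) gen_loop.simps) (auto split: prod.splits)
    have h: "hamming a w < hamming a v" using gen_pass_decreases[OF p] False by simp
    have len: "length w = length v" using gen_pass_below[OF p] by (simp add: below_def)
    note c2 = less.hyps[OF h l, unfolded len]
    have "(hamming a w + 1) * x \<le> hamming a v * x" for x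
      using h by (intro mult_right_mono) auto
    then have "bmc_checks c2 \<le> hamming a v * length v" "time c2 \<le> hamming a v * (1 + 5 * length v)"
      using c2 le_trans by blast+
    with c c1 c2 show ?thesis by simp
  qed
qed

lemma gen_loop_minimal:
  assumes "\<And>x. x \<in> J \<Longrightarrow> safe x" and "J \<subseteq> states n"
    and "\<And>v j b. v \<in> J \<Longrightarrow> j < n \<Longrightarrow> safe (v[j := b]) \<Longrightarrow> v[j := b] \<in> J"
  shows "gen_loop safe a v = (u, c) \<Longrightarrow> v \<in> J \<Longrightarrow> minimal_in J a u \<and> below a u v"
proof (induction "hamming a v" arbitrary: v u c rule: less_induct)
  case less
  have n: "length v = n" using less.prems assms(2) by (auto simp: states_def)
  obtain w c1 where p: "gen_pass safe a [0..<length v] v = (w, c1)" by (metis surj_pair)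
  show ?case
  proof (cases "w = v")
    case True
    then have "u = v" using less.prems p by (subst (asm) gen_loop.simps) simp
    \<comment> \<open>The oracle accepts all of \<open>J\<close>, so a flip rejected in the last
      pass leads outside \<open>J\<close>.\<close>
    moreover have "v[j := a ! j] \<notin> J" if "j < length v" "v ! j \<noteq> a ! j" for j
      using gen_pass_fixed[of safe a "[0..<length v]" v c1 j] p True that assms(1) by force
    ultimately show ?thesis using less.prems by (simp add: minimal_in_def below_refl)
  next
    case False
    then obtain c2 where l: "gen_loop safe a w = (u, c2)"
      using less.prems p by (subst (asm) gen_loop.simps) (auto split: prod.splits)
    have h: "hamming a w < hamming a v" using gen_pass_decreases[OF p] False by simp
    have "w \<in> J" by (rule gen_pass_closed[OF _ p]) (use assms(3) less.prems n in auto)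
    from less.hyps[OF h l this] show ?thesis using gen_pass_below[OF p] below_trans by blast
  qed
qed

section \<open>Counting minimal points of the complement of a CNF\<close>

lemma card_minimal_in_cnf:
  assumes F: "cnf_over n F"
  shows "card {v. minimal_in (states n - cnf_models n F) a v} \<le> length F" (is "card ?M \<le> _")
proof -
  \<comment> \<open>\<open>g c\<close> falsifies \<open>c\<close> and agrees with \<open>a\<close>
    elsewhere. On a tautological clause its value is arbitrary, since no state falsifies such a
    clause.\<close>
  define g where "g c = map (\<lambda>i. if (i, True) \<in> set c then False
    else if (i, False) \<in> set c then True else a ! i) [0..<n]" for c :: clause
  have "v \<in> g ` set F" if "minimal_in (states n - cnf_models n F) a v" for v
  proof -
    have v: "length v = n" "\<not> sat_cnf v F"
      using that by (auto simp: minimal_in_def states_def cnf_models_def)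
    then obtain c where c: "c \<in> set F" "\<forall>l \<in> set c. \<not> sat_lit v l" by (auto simp: sat_cnf_def)
    have free: "v ! i = a ! i" if i: "i < n" "\<forall>b. (i, b) \<notin> set c" for i
    proof (rule ccontr)
      assume "v ! i \<noteq> a ! i"
      \<comment> \<open>By minimality the flipped state is a model of \<open>F\<close>; yet
        \<open>c\<close> does not mention \<open>i\<close> and is still falsified.\<close>
      then have "sat_cnf (v[i := a ! i]) F"
        using that \<open>minimal_in _ a v\<close> v i by (auto simp: minimal_in_def states_def cnf_models_def)
      then obtain l where l: "l \<in> set c" "sat_lit (v[i := a ! i]) l"
        using c(1) by (auto simp: sat_cnf_def)
      then have "fst l \<noteq> i" using i(2) by (metis prod.collapse)
      then show False using l c(2) by (auto simp: sat_lit_def)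
    qed
    have "v = g c"
    proof (rule nth_equalityI)
      show "length v = length (g c)" by (simp add: g_def v)
      fix i assume "i < length v"
      then have i: "i < n" using v by simp
      show "v ! i = g c ! i"
      proof (cases "\<forall>b. (i, b) \<notin> set c")
        case True
        then show ?thesis using free[OF i] i by (simp add: g_def)
      next
        case False
        then obtain b where "(i, b) \<in> set c" by blast
        moreover have "v ! i = (\<not> b)" if "(i, b) \<in> set c" for b
          using c(2) that by (force simp: sat_lit_def)
        ultimately show ?thesis using i by (cases b) (auto simp: g_def)
      qed
    qed
    with c(1) show ?thesis by blast
  qed
  then have "card ?M \<le> card (g ` set F)" by (intro card_mono) auto
  also have "\<dots> \<le> length F" by (meson card_image_le card_length finite_set le_trans)
  finally show ?thesis .
qed

section \<open>Runs of the algorithm\<close>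

text \<open>One query for the starting state, then at most \<open>n + 1\<close> passes of at most
  \<open>n\<close> queries.\<close>

definition gen_checks :: "'a::comm_semiring_1 \<Rightarrow> 'a" where
  "gen_checks n = 1 + (n + 1) * n"

text \<open>The initial query, \<open>2 * n\<close> operations for the input state and the resulting
  cube, and at most \<open>n + 1\<close> passes.\<close>

definition gen_time :: "'a::comm_semiring_1 \<Rightarrow> 'a" where
  "gen_time n = 1 + 2 * n + (n + 1) * (1 + 5 * n)"

definition size_bound :: "'a::comm_semiring_1 \<Rightarrow> 'a \<Rightarrow> 'a" where
  "size_bound n m = 1 + m * (1 + n)"

text \<open>Each of the \<open>t\<close> components is evaluated, generalized at most once and
  extended by one list cell.\<close>

definition update_time :: "'a::comm_semiring_1 \<Rightarrow> 'a \<Rightarrow> 'a \<Rightarrow> 'a" where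
  "update_time n m t = t * (size_bound n m + gen_time n + 1)"

text \<open>Polymorphic, so that one expression serves as a bound (on \<open>nat\<close>) and as a polynomial
  (on \<open>nat poly\<close>).\<close>

definition cost_bound :: "'a::comm_semiring_1 \<Rightarrow> 'a \<Rightarrow> 'a \<Rightarrow> 'a" where
  "cost_bound n m t = 1 + m * t * (t * gen_checks n + update_time n m t + 1)
     + t * (1 + n) + t * size_bound n m"

lemma sum_list_map_le:
  fixes f :: "'a \<Rightarrow> nat"
  assumes "\<And>x. x \<in> set xs \<Longrightarrow> f x \<le> b"
  shows "(\<Sum>x\<leftarrow>xs. f x) \<le> length xs * b"
  using sum_list_mono[of xs f "\<lambda>_. b"] assms by (simp add: sum_list_triv)

lemma finite_states: "finite (states n)"
  using finite_lists_length_eq[of "UNIV :: bool set" n] by (simp add: states_def)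

section \<open>Runs guided by an invariant \<open>J\<close> unknown to the algorithm\<close>

text \<open>\<open>fence\<close> keeps generalization inside \<open>J\<close>, \<open>span\<close>
  makes \<open>J\<close> the intersection of its monotone hulls over the basis, and
  \<open>few_minimal\<close> limits the available cubes. The intended instance is the dual system
  with \<open>J\<close> the complement of \<open>I\<close>.\<close>

locale lambda_inference =
  fixes n k m :: nat and Init :: "state set" and \<delta> :: "(state \<times> state) set" and Bad :: "state set"
    and ts :: "state list" and J :: "state set"
  assumes invariant: "inductive_invariant n Init \<delta> Bad J"
    and fence: "\<And>v j b. v \<in> J \<Longrightarrow> j < n \<Longrightarrow> bmc_safe \<delta> k Bad (v[j := b]) \<Longrightarrow> v[j := b] \<in> J"
    and span: "\<And>\<sigma>. \<sigma> \<in> states n \<Longrightarrow> (\<And>a. a \<in> set ts \<Longrightarrow> \<exists>v \<in> J. below a v \<sigma>) \<Longrightarrow> \<sigma> \<in> J"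
    and few_minimal: "\<And>a. card {v. minimal_in J a v} \<le> m"
    and basis: "set ts \<subseteq> states n"
begin

abbreviation safe :: "state \<Rightarrow> bool" where
  "safe \<equiv> bmc_safe \<delta> k Bad"

lemma J_states: "J \<subseteq> states n"
  using invariant by (simp add: inductive_invariant_def)

text \<open>\<open>J\<close> is closed under \<open>\<delta>\<close> and avoids \<open>Bad\<close>,
  whatever the bound \<open>k\<close>. Hence generalization from \<open>J\<close> never
  fails.\<close>

lemma safe_if_in_J:
  assumes "x \<in> J"
  shows "safe x"
proof -
  have "y \<in> J" if "(x, y) \<in> \<delta> ^^ i" for i y
    using that
  proof (induction i arbitrary: y)
    case (Suc i)
    then show ?case using invariant by (auto simp: inductive_invariant_def)
  qed (use assms in simp)
  then show ?thesis using invariant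
    by (fastforce simp: bmc_safe_def reach_le_def inductive_invariant_def)
qed

text \<open>Such a \<open>D\<close> lies within the monotone hull of \<open>J\<close> at
  \<open>a\<close>. Distinctness lets the length of \<open>D\<close> count minimal points.\<close>

definition approx :: "state \<Rightarrow> dnf \<Rightarrow> bool" where
  "approx a D \<longleftrightarrow> distinct D \<and> set D \<subseteq> mono_cube a ` {v. minimal_in J a v}"

lemma approx_length:
  assumes "approx a D"
  shows "length D \<le> m"
proof -
  \<comment> \<open>An infinite set has cardinality 0, so \<open>few_minimal\<close> is informative
    only together with finiteness.\<close>
  have fin: "finite {v. minimal_in J a v}"
    by (rule finite_subset[OF _ finite_states[of n]]) (use J_states in \<open>auto simp: minimal_in_def\<close>)
  have "length D = card (set D)" using assms by (simp add: approx_def distinct_card)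
  also have "\<dots> \<le> card (mono_cube a ` {v. minimal_in J a v})"
    using assms fin by (intro card_mono) (auto simp: approx_def)
  also have "\<dots> \<le> m" using card_image_le[OF fin] few_minimal le_trans by blast
  finally show ?thesis .
qed

lemma approx_size:
  assumes "approx a D"
  shows "dnf_size D \<le> size_bound n m"
proof -
  have "length c \<le> n" if "c \<in> set D" for c
  proof -
    obtain v where "v \<in> J" "c = mono_cube a v"
      using assms \<open>c \<in> set D\<close> unfolding approx_def minimal_in_def by blast
    then show ?thesis using length_mono_cube[of a v] J_states by (auto simp: states_def)
  qed
  then have "(\<Sum>c\<leftarrow>D. 1 + length c) \<le> length D * (1 + n)" by (intro sum_list_map_le) simp
  also have "\<dots> \<le> m * (1 + n)" using approx_length[OF assms] by (intro mult_right_mono) auto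
  finally show ?thesis by (simp add: dnf_size_def size_bound_def)
qed

lemma approx_below:
  assumes "approx a D" "sat_dnf \<sigma> D" "\<sigma> \<in> states n"
  shows "\<exists>v \<in> J. below a v \<sigma>"
proof -
  obtain v where v: "v \<in> J" "\<forall>l \<in> set (mono_cube a v). sat_lit \<sigma> l"
    using assms(1,2) unfolding approx_def sat_dnf_def minimal_in_def by blast
  then have "length v = length \<sigma>" using J_states assms(3) by (auto simp: states_def)
  with v sat_mono_cube show ?thesis by blast
qed

text \<open>Each conjunct stays within the hull of \<open>J\<close> at its own translation, and
  \<open>span\<close> intersects these hulls.\<close>

lemma conj_models_subset:
  assumes "list_all2 approx ts Hs"
  shows "conj_models n Hs \<subseteq> J"
proof
  fix \<sigma> assume \<sigma>: "\<sigma> \<in> conj_models n Hs"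
  show "\<sigma> \<in> J"
  proof (rule span)
    show s: "\<sigma> \<in> states n" using \<sigma> by (simp add: conj_models_def)
    fix a assume "a \<in> set ts"
    then obtain D where "D \<in> set Hs" "approx a D"
      using assms by (metis in_set_conv_nth list_all2_conv_all_nth)
    then show "\<exists>v \<in> J. below a v \<sigma>"
      using \<sigma> s approx_below by (auto simp: conj_models_def)
  qed
qed

lemma mon_gen_bmc_in_J:
  assumes "\<sigma> \<in> J"
  obtains v c where "mon_gen_bmc safe \<sigma> a = (Some (mono_cube a v), c)"
    "minimal_in J a v" "below a v \<sigma>"
    "ind_checks c = 0" "bmc_checks c \<le> gen_checks n" "time c \<le> gen_time n"
proof -
  obtain v c where g: "gen_loop safe a \<sigma> = (v, c)" by (metis surj_pair)
  have v: "minimal_in J a v \<and> below a v \<sigma>"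
    by (rule gen_loop_minimal[OF _ _ _ g]) (use assms J_states fence safe_if_in_J in auto)
  then have len: "length \<sigma> = n" "length v = n"
    using assms J_states by (auto simp: states_def below_def)
  have "(hamming a \<sigma> + 1) * x \<le> (n + 1) * x" for x
    using hamming_le[of a \<sigma>] len by (intro mult_right_mono) auto
  then have "bmc_checks c \<le> (n + 1) * n" "time c \<le> (n + 1) * (1 + 5 * n)" "ind_checks c = 0"
    using gen_loop_cost[OF g] len le_trans by metis+
  then show ?thesis
    using that[of v "bmc_check + ops (length \<sigma>) + c + ops (length v)"] safe_if_in_J[OF assms] g v len
    by (simp add: mon_gen_bmc_def gen_checks_def gen_time_def)
qed

text \<open>The total number of cubes is the potential: it grows as soon as one component rejects
  \<open>\<sigma>\<close>.\<close>

lemma update_in_J: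
  assumes "list_all2 approx as Hs" "\<sigma> \<in> J"
  obtains Hs' c where "update safe \<sigma> (zip as Hs) = (Some Hs', c)" "list_all2 approx as Hs'"
    "(\<Sum>D\<leftarrow>Hs. length D) + (if \<forall>D \<in> set Hs. sat_dnf \<sigma> D then 0 else 1) \<le> (\<Sum>D\<leftarrow>Hs'. length D)"
    "ind_checks c = 0" "bmc_checks c \<le> length as * gen_checks n"
    "time c \<le> update_time n m (length as)"
proof -
  have "\<exists>Hs' c. update safe \<sigma> (zip as Hs) = (Some Hs', c) \<and> list_all2 approx as Hs' \<and>
    (\<Sum>D\<leftarrow>Hs. length D) + (if \<forall>D \<in> set Hs. sat_dnf \<sigma> D then 0 else 1) \<le> (\<Sum>D\<leftarrow>Hs'. length D) \<and>
    ind_checks c = 0 \<and> bmc_checks c \<le> length as * gen_checks n \<and>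
    time c \<le> length as * (size_bound n m + gen_time n + 1)"
    using assms(1)
  proof (induction rule: list_all2_induct)
    case (Cons a as D Hs)
    then obtain Hs' c where IH: "update safe \<sigma> (zip as Hs) = (Some Hs', c)" "list_all2 approx as Hs'"
      "(\<Sum>D\<leftarrow>Hs. length D) + (if \<forall>D \<in> set Hs. sat_dnf \<sigma> D then 0 else 1) \<le> (\<Sum>D\<leftarrow>Hs'. length D)"
      "ind_checks c = 0" "bmc_checks c \<le> length as * gen_checks n"
      "time c \<le> length as * (size_bound n m + gen_time n + 1)"
      by blast
    note size = approx_size[OF Cons.hyps(1)]
    show ?case
    proof (cases "sat_dnf \<sigma> D")
      case True
      with IH size Cons.hyps(1) show ?thesis by auto
    next
      case False
      obtain v c' where v: "mon_gen_bmc safe \<sigma> a = (Some (mono_cube a v), c')"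
        "minimal_in J a v" "below a v \<sigma>"
        and c': "ind_checks c' = 0" "bmc_checks c' \<le> gen_checks n" "time c' \<le> gen_time n"
        using mon_gen_bmc_in_J[OF assms(2)] by metis
      \<comment> \<open>The new cube holds at \<open>\<sigma>\<close>, while no cube of
        \<open>D\<close> does.\<close>
      have "mono_cube a v \<notin> set D"
        using False v(3) sat_mono_cube[of v \<sigma> a] by (auto simp: sat_dnf_def below_def)
      then have "approx a (mono_cube a v # D)"
        using Cons.hyps(1) v(2) by (simp add: approx_def)
      with IH size False v(1) c' show ?thesis by (auto split: if_splits)
    qed
  qed simp
  with that show ?thesis unfolding update_time_def by blast
qed

lemma counterexample_in_J:
  assumes "H \<subseteq> J" "counterexample Init \<delta> H \<sigma>"
  shows "\<sigma> \<in> J" "\<sigma> \<notin> H"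
  using assms invariant by (auto simp: counterexample_def inductive_invariant_def)

text \<open>A violation of safety would yield no counterexample, but \<open>H \<subseteq> J\<close>
  already excludes \<open>Bad\<close>. So initiation or consecution fails, and the loop is never
  stuck.\<close>

lemma counterexample_exists:
  assumes "H \<subseteq> J" "\<not> inductive_invariant n Init \<delta> Bad H"
  obtains \<sigma> where "counterexample Init \<delta> H \<sigma>"
  using assms invariant by (fastforce simp: counterexample_def inductive_invariant_def)

abbreviation "t \<equiv> length ts"

section \<open>Run invariant, termination and cost\<close>

text \<open>Costs are charged to the number \<open>s\<close> of cubes collected so far, since each
  iteration adds at least one. On return \<open>s\<close> is replaced by its maximum
  \<open>m * t\<close>, and the last check and evaluation are added.\<close>

fun run_inv :: "config \<Rightarrow> bool" where
  "run_inv (Running Hs c) \<longleftrightarrow> list_all2 approx ts Hs \<and>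
     (let s = \<Sum>D\<leftarrow>Hs. length D
      in ind_checks c \<le> s \<and> bmc_checks c \<le> s * (t * gen_checks n) \<and>
         time c \<le> t * (1 + n) + s * (update_time n m t + 1))"
| "run_inv (Failed c) \<longleftrightarrow> False"
| "run_inv (Returned Hs c) \<longleftrightarrow> inductive_invariant n Init \<delta> Bad (conj_models n Hs) \<and>
     ind_checks c \<le> 1 + m * t \<and> bmc_checks c \<le> m * t * (t * gen_checks n) \<and>
     time c \<le> t * (1 + n) + m * t * (update_time n m t + 1) + 1 + t * size_bound n m"

lemma number_of_cubes_le:
  assumes "list_all2 approx ts Hs"
  shows "(\<Sum>D\<leftarrow>Hs. length D) \<le> m * t"
proof -
  have "length D \<le> m" if "D \<in> set Hs" for D
    using assms that approx_length by (metis in_set_conv_nth list_all2_conv_all_nth)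
  then have "(\<Sum>D\<leftarrow>Hs. length D) \<le> length Hs * m" by (intro sum_list_map_le)
  then show ?thesis using list_all2_lengthD[OF assms] by (simp add: mult.commute)
qed

lemma run_inv_start: "run_inv (lambda_start ts)"
proof -
  have "(\<Sum>a\<leftarrow>ts. 1 + length a) \<le> t * (1 + n)"
    using basis by (intro sum_list_map_le) (auto simp: states_def)
  moreover have "list_all2 approx ts (replicate t [])"
    by (simp add: list_all2_conv_all_nth approx_def)
  ultimately show ?thesis by (simp add: lambda_start_def sum_list_replicate)
qed

text \<open>The \<open>Suc\<close> keeps a running configuration with all \<open>m * t\<close> cubes
  above a returned one.\<close>

fun rank :: "config \<Rightarrow> nat" where
  "rank (Running Hs c) = Suc (m * t) - (\<Sum>D\<leftarrow>Hs. length D)"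
| "rank _ = 0"

text \<open>The counterexample lies in \<open>J\<close> but outside the candidate, so some component
  rejects it and gains a cube.\<close>

lemma refine_step:
  assumes inv: "run_inv (Running Hs c)" and ex: "counterexample Init \<delta> (conj_models n Hs) \<sigma>"
  obtains Hs' c' where "update safe \<sigma> (zip ts Hs) = (Some Hs', c')"
    "run_inv (Running Hs' (c + ind_check + c'))"
    "rank (Running Hs' (c + ind_check + c')) < rank (Running Hs c)"
proof -
  have approx: "list_all2 approx ts Hs" using inv by (simp add: Let_def)
  note sub = conj_models_subset[OF approx]
  note \<sigma> = counterexample_in_J[OF sub ex]
  have new: "\<not> (\<forall>D \<in> set Hs. sat_dnf \<sigma> D)"
    using \<sigma> J_states by (auto simp: conj_models_def)
  obtain Hs' c' where u: "update safe \<sigma> (zip ts Hs) = (Some Hs', c')" "list_all2 approx ts Hs'"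
    "(\<Sum>D\<leftarrow>Hs. length D) + (if \<forall>D \<in> set Hs. sat_dnf \<sigma> D then 0 else 1) \<le> (\<Sum>D\<leftarrow>Hs'. length D)"
    "ind_checks c' = 0" "bmc_checks c' \<le> t * gen_checks n" "time c' \<le> update_time n m t"
    by (rule update_in_J[OF approx \<sigma>(1)])
  have more: "Suc (\<Sum>D\<leftarrow>Hs. length D) \<le> (\<Sum>D\<leftarrow>Hs'. length D)" using u(3) new by simp
  \<comment> \<open>The added cube pays the price \<open>x\<close> of this iteration.\<close>
  have step: "s * x + x \<le> s' * x" if "Suc s \<le> s'" for s s' x :: nat
    using mult_right_mono[OF that, of x] by simp
  have "run_inv (Running Hs' (c + ind_check + c'))"
    using inv u(2,4-) more step[OF more, of "t * gen_checks n"] step[OF more, of "update_time n m t + 1"]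
    by (simp add: Let_def)
  moreover have "rank (Running Hs' (c + ind_check + c')) < rank (Running Hs c)"
    using more number_of_cubes_le[OF u(2)] by simp
  ultimately show ?thesis using that u(1) by blast
qed

lemma run_inv_return:
  assumes "run_inv (Running Hs c)" "inductive_invariant n Init \<delta> Bad (conj_models n Hs)"
  shows "run_inv (Returned Hs (c + ind_check + ops (\<Sum>D\<leftarrow>Hs. dnf_size D)))"
proof -
  define s where "s = (\<Sum>D\<leftarrow>Hs. length D)"
  have approx: "list_all2 approx ts Hs" using assms(1) by (simp add: Let_def)
  have s: "s \<le> m * t" using number_of_cubes_le[OF approx] by (simp add: s_def)
  have "dnf_size D \<le> size_bound n m" if "D \<in> set Hs" for D
    using approx that approx_size by (metis in_set_conv_nth list_all2_conv_all_nth)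
  then have "(\<Sum>D\<leftarrow>Hs. dnf_size D) \<le> length Hs * size_bound n m" by (intro sum_list_map_le)
  then have "(\<Sum>D\<leftarrow>Hs. dnf_size D) \<le> t * size_bound n m"
    using list_all2_lengthD[OF approx] by simp
  moreover have "ind_checks c \<le> s" "bmc_checks c \<le> s * (t * gen_checks n)"
    "time c \<le> t * (1 + n) + s * (update_time n m t + 1)"
    using assms(1) by (simp_all add: Let_def s_def)
  moreover from this(2) have "bmc_checks c \<le> m * t * (t * gen_checks n)"
    by (rule le_trans[OF _ mult_right_mono[OF s]]) simp
  ultimately show ?thesis
    using assms(2) s mult_right_mono[OF s, of "update_time n m t + 1"] by simp
qed

abbreviation "step \<equiv> lambda_step n Init \<delta> Bad k ts"

lemma step_run_inv:
  assumes "step conf conf'" "run_inv conf"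
  shows "run_inv conf' \<and> rank conf' < rank conf"
  using assms
proof cases
  case (return Hs c)
  then show ?thesis using run_inv_return number_of_cubes_le assms(2)
    by (auto simp: Let_def less_Suc_eq_le simp del: run_inv.simps(3))
next
  case (refine Hs \<sigma> Hs' c' c)
  then show ?thesis using refine_step assms(2) by (metis option.inject prod.inject)
next
  \<comment> \<open>Contradictory: \<open>update\<close> is a function and succeeds on this
    counterexample.\<close>
  case (fail Hs \<sigma> c' c)
  then show ?thesis using refine_step assms(2) by (metis option.distinct(1) prod.inject)
qed

lemma reachable_run_inv:
  "step\<^sup>*\<^sup>* (lambda_start ts) conf \<Longrightarrow> run_inv conf"
  by (induction rule: rtranclp_induct) (use run_inv_start step_run_inv in auto)

lemma no_infinite_run:
  assumes "run 0 = lambda_start ts" "\<And>i. step (run i) (run (Suc i))"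
  shows False
proof -
  have "run_inv (run i) \<and> rank (run i) + i \<le> rank (run 0)" for i
  proof (induction i)
    case (Suc i)
    then show ?case using step_run_inv[OF assms(2)[of i]] by simp
  qed (simp add: assms(1) run_inv_start)
  from this[of "Suc (rank (run 0))"] show False by simp
qed

lemma final_config:
  assumes "step\<^sup>*\<^sup>* (lambda_start ts) conf" "\<nexists>conf'. step conf conf'"
  obtains Hs c where "conf = Returned Hs c" "inductive_invariant n Init \<delta> Bad (conj_models n Hs)"
proof (cases conf)
  case (Running Hs c)
  have inv: "run_inv (Running Hs c)" using reachable_run_inv assms(1) Running by blast
  then have sub: "conj_models n Hs \<subseteq> J" using conj_models_subset by (simp add: Let_def)
  have "\<exists>conf'. step conf conf'"
  proof (cases "inductive_invariant n Init \<delta> Bad (conj_models n Hs)")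
    case True
    then show ?thesis using Running lambda_step.return by blast
  next
    case False
    then obtain \<sigma> where ex: "counterexample Init \<delta> (conj_models n Hs) \<sigma>"
      using counterexample_exists[OF sub] by blast
    with False show ?thesis using refine_step[OF inv ex] Running lambda_step.refine by metis
  qed
  with assms(2) show ?thesis by blast
qed (use reachable_run_inv[OF assms(1)] that in auto)

lemma reachable_cost:
  assumes "step\<^sup>*\<^sup>* (lambda_start ts) conf"
  shows "ind_checks (cost_of conf) \<le> cost_bound n m t"
    "bmc_checks (cost_of conf) \<le> cost_bound n m t" "time (cost_of conf) \<le> cost_bound n m t"
proof -
  have "ind_checks (cost_of conf) \<le> 1 + m * t \<and>
    bmc_checks (cost_of conf) \<le> m * t * (t * gen_checks n) \<and>
    time (cost_of conf) \<le> t * (1 + n) + m * t * (update_time n m t + 1) + 1 + t * size_bound n m"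
  proof (cases conf)
    case (Running Hs c)
    with reachable_run_inv[OF assms] have inv: "run_inv (Running Hs c)" by simp
    then have s: "(\<Sum>D\<leftarrow>Hs. length D) \<le> m * t" using number_of_cubes_le by (simp add: Let_def)
    have "bmc_checks c \<le> (\<Sum>D\<leftarrow>Hs. length D) * (t * gen_checks n)" using inv by (simp add: Let_def)
    then have "bmc_checks c \<le> m * t * (t * gen_checks n)"
      by (rule le_trans[OF _ mult_right_mono[OF s]]) simp
    then show ?thesis
      using Running inv s mult_right_mono[OF s, of "update_time n m t + 1"] by (simp add: Let_def)
  qed (use reachable_run_inv[OF assms] in auto)
  \<comment> \<open>\<open>cost_bound\<close> contains the terms of all three estimates and so
    dominates each.\<close>
  then show "ind_checks (cost_of conf) \<le> cost_bound n m t"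
    "bmc_checks (cost_of conf) \<le> cost_bound n m t" "time (cost_of conf) \<le> cost_bound n m t"
    by (simp_all add: cost_bound_def algebra_simps)
qed

end

section \<open>The dual system\<close>

text \<open>Every sparse translation is the indicator of a list of exactly \<open>r\<close> entries
  from \<open>{..n}\<close>, and there are \<open>(n + 1) ^ r\<close> such lists.\<close>

lemma card_sparse_translations: "card (sparse_translations n r) \<le> (n + 1) ^ r"
proof -
  define g where "g xs = map (\<lambda>j. j \<in> set xs) [0..<n]" for xs :: "nat list"
  define L where "L = {xs. set xs \<subseteq> {..n} \<and> length xs = r}"
  have "a \<in> g ` L" if a: "a \<in> sparse_translations n r" for a
  proof -
    define A where "A = {j. j < n \<and> a ! j}"
    have "finite A" "card A \<le> r" "length a = n"
      using a by (auto simp: A_def sparse_translations_def states_def)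
    then obtain ys where ys: "set ys = A" "length ys \<le> r"
      by (metis distinct_card finite_distinct_list)
    \<comment> \<open>\<open>n\<close> is not a variable and serves as padding\<close>
    let ?xs = "ys @ replicate (r - length ys) n"
    have "A \<subseteq> {..n}" by (auto simp: A_def)
    then have "?xs \<in> L" using ys by (simp add: L_def set_replicate_conv_if)
    moreover have "a = g ?xs"
    proof (rule nth_equalityI)
      fix i assume "i < length a"
      then have "i < n" using \<open>length a = n\<close> by simp
      then have "i \<in> set ?xs \<longleftrightarrow> a ! i" using ys(1) by (simp add: A_def)
      then show "a ! i = g ?xs ! i" using \<open>i < n\<close> by (simp add: g_def del: set_append)
    qed (simp add: g_def \<open>length a = n\<close>)
    ultimately show ?thesis by blast
  qed
  then have "sparse_translations n r \<subseteq> g ` L" by blast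
  moreover have "finite L" "card L = (n + 1) ^ r"
    by (simp_all add: L_def finite_lists_length_eq card_lists_length_eq)
  ultimately show ?thesis by (metis card_image_le card_mono finite_imageI le_trans)
qed

text \<open>Each bit of \<open>v\<close> is taken from \<open>a\<close> or from \<open>x\<close>. If
  \<open>a\<close> is true only where \<open>x\<close> is, variables false in \<open>x\<close> stay
  false and negative literals survive; a picked variable is true in both and saves its clause. At
  most \<open>r\<close> clauses call for a pick.\<close>

lemma exists_separating_translation:
  assumes F: "almost_antimonotone r F" "cnf_over n F" and x: "x \<in> cnf_models n F"
  obtains a where "a \<in> sparse_translations n r" "\<And>v. below a v x \<Longrightarrow> v \<in> cnf_models n F"
proof -
  define C where "C = filter (\<lambda>c. \<exists>l \<in> set c. snd l) F"
  define pick where "pick c = (SOME j. (j, True) \<in> set c \<and> x ! j)" for c :: clause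
  define C' where "C' = {c \<in> set C. \<exists>j. (j, True) \<in> set c \<and> x ! j}"
  have pick: "(pick c, True) \<in> set c" "x ! pick c" if "c \<in> C'" for c
    using someI_ex[of "\<lambda>j. (j, True) \<in> set c \<and> x ! j"] that by (auto simp: C'_def pick_def)
  define a where "a = map (\<lambda>j. j \<in> pick ` C') [0..<n]"
  have len: "length x = n" using x by (simp add: cnf_models_def states_def)
  have "card {j. j < n \<and> a ! j} \<le> card (pick ` C')"
    by (intro card_mono) (auto simp: a_def C'_def)
  also have "\<dots> \<le> card C'" by (rule card_image_le) (simp add: C'_def)
  also have "\<dots> \<le> card (set C)" by (rule card_mono) (auto simp: C'_def)
  also have "\<dots> \<le> r"
    using card_length[of C] F(1) by (simp add: C_def almost_antimonotone_def)
  finally have "a \<in> sparse_translations n r"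
    by (simp add: sparse_translations_def states_def a_def)
  moreover have "v \<in> cnf_models n F" if v: "below a v x" for v
  proof -
    have neg: "\<not> v ! j" if "j < n" "\<not> x ! j" for j
      using v that len pick by (fastforce simp: below_def a_def)
    have "\<exists>l \<in> set c. sat_lit v l" if c: "c \<in> set F" for c
    proof (cases "c \<in> C'")
      case True
      then have "pick c < n" using pick(1) c F(2) by (fastforce simp: cnf_over_def)
      then have "v ! pick c"
        using v len True pick(2)[OF True] by (fastforce simp: below_def a_def)
      then show ?thesis using pick(1)[OF True] by (force simp: sat_lit_def)
    next
      case False
      obtain l where l: "l \<in> set c" "sat_lit x l"
        using x c by (auto simp: cnf_models_def sat_cnf_def)
      \<comment> \<open>Outside \<open>C'\<close> the state \<open>x\<close> satisfies the clause by
        negative literals only.\<close>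
      have "\<not> snd l"
      proof
        assume "snd l"
        with l have "(fst l, True) \<in> set c" "x ! fst l" by (auto simp: sat_lit_def) (metis prod.collapse)
        with False c show False by (force simp: C'_def C_def)
      qed
      moreover have "fst l < n" using l(1) c F(2) by (auto simp: cnf_over_def)
      ultimately show ?thesis using neg l by (auto simp: sat_lit_def)
    qed
    then show ?thesis using v len by (auto simp: cnf_models_def sat_cnf_def states_def below_def)
  qed
  ultimately show ?thesis using that by blast
qed

section \<open>Passing to the dual system\<close>

text \<open>Consecution for the complement is the contrapositive, while initiation and safety change
  places. The conjunct \<open>I \<subseteq> states n\<close> restores what
  \<open>states n - I\<close> forgets.\<close>

lemma inductive_invariant_dual:
  assumes "transition_system n Init \<delta> Bad"
  shows "inductive_invariant n Bad (\<delta>\<inverse>) Init (states n - I) \<and> I \<subseteq> states n \<longleftrightarrow>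
    inductive_invariant n Init \<delta> Bad I"
proof -
  have "Bad \<subseteq> states n" "Init \<subseteq> states n" "\<delta> \<subseteq> states n \<times> states n"
    using assms by (auto simp: transition_system_def)
  moreover from this(3) have "(\<forall>(\<sigma>, \<sigma>') \<in> \<delta>\<inverse>. \<sigma> \<in> states n - I \<longrightarrow> \<sigma>' \<in> states n - I) \<longleftrightarrow>
    (\<forall>(\<sigma>, \<sigma>') \<in> \<delta>. \<sigma> \<in> I \<longrightarrow> \<sigma>' \<in> I)" if "I \<subseteq> states n"
    using that by fast
  ultimately show ?thesis unfolding inductive_invariant_def by blast
qed

lemma relpow_converse:
  fixes R :: "('a \<times> 'a) set"
  shows "(R\<inverse>) ^^ i = (R ^^ i)\<inverse>"
proof (induction i)
  case (Suc i)
  have "(R \<inverse>) ^^ Suc i = (R ^^ i)\<inverse> O R\<inverse>" by (simp add: Suc)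
  also have "\<dots> = (R O R ^^ i)\<inverse>" by (simp add: converse_relcomp)
  \<comment> \<open>The extra step ends up on the other side, which is harmless since
    \<open>R\<close> commutes with its powers.\<close>
  finally show ?case by (simp add: relpow_commute[symmetric])
qed simp

lemma reach_le_converse:
  "y \<in> reach_le (\<delta>\<inverse>) k {x} \<longleftrightarrow> x \<in> reach_le \<delta> k {y}"
  by (auto simp: reach_le_def relpow_converse)

text \<open>A flip from outside \<open>I\<close> into \<open>I\<close> lands on the inner boundary,
  which \<open>Init\<close> reaches within \<open>k\<close> steps. Searching backwards from there
  meets \<open>Init\<close>, so the dual oracle rejects it.\<close>

lemma fence_dual:
  assumes fenced: "forwards_fenced n Init \<delta> k I" and v: "v \<in> states n - I" and j: "j < n"
    and safe: "bmc_safe (\<delta>\<inverse>) k Init (v[j := b])"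
  shows "v[j := b] \<in> states n - I"
proof (rule ccontr)
  assume "v[j := b] \<notin> states n - I"
  then have x: "v[j := b] \<in> I" using v by (simp add: states_def)
  have "v ! j \<noteq> b"
  proof
    assume "v ! j = b"
    then have "v[j := b] = v" using list_update_id[of v j] by (simp only:)
    then show False using x v by simp
  qed
  then have "neighbors n (v[j := b]) v"
    using v j unfolding neighbors_def states_def
    by (auto intro!: ex1I[of _ j] simp: nth_list_update split: if_splits)
  then have "v[j := b] \<in> reach_le \<delta> k Init"
    using x v fenced by (auto simp: forwards_fenced_def inner_boundary_def)
  then obtain y where "y \<in> Init" "v[j := b] \<in> reach_le \<delta> k {y}" by (auto simp: reach_le_def)
  then show False using safe reach_le_converse[of y \<delta> k "v[j := b]"] unfolding bmc_safe_def by blast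
qed

lemma cost_bound_mono:
  fixes n m t :: nat
  assumes "n \<le> n'" "m \<le> m'" "t \<le> t'"
  shows "cost_bound n m t \<le> cost_bound n' m' t'"
  unfolding cost_bound_def update_time_def gen_checks_def gen_time_def size_bound_def
  using assms by (intro add_mono mult_mono) auto

text \<open>Polynomial evaluation is a semiring homomorphism, and \<open>cost_bound\<close> is built
  from semiring operations.\<close>

lemma poly_cost_bound: "poly (cost_bound p q s) x = cost_bound (poly p x) (poly q x) (poly s x)"
  by (simp add: cost_bound_def update_time_def gen_checks_def gen_time_def size_bound_def)

theorem corollary6p12:
  fixes r :: nat
  shows "\<exists>P :: nat poly.
    \<forall>(n :: nat) (k :: nat) (m :: nat) Init \<delta> Bad I (F :: cnf) (ts :: state list).
      transition_system n Init \<delta> Bad \<longrightarrow>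
      inductive_invariant n Init \<delta> Bad I \<longrightarrow>
      forwards_fenced n Init \<delta> k I \<longrightarrow>
      cnf_over n F \<longrightarrow> I = cnf_models n F \<longrightarrow> length F = m \<longrightarrow> almost_antimonotone r F \<longrightarrow>
      distinct ts \<longrightarrow> set ts = sparse_translations n r \<longrightarrow>
        dual_converges n Init \<delta> Bad k ts \<and>
        (\<forall>conf. (dual_step n Init \<delta> Bad k ts)\<^sup>*\<^sup>* (lambda_start ts) conf \<longrightarrow>
           ind_checks (cost_of conf) \<le> poly P (m * n) \<and>
           bmc_checks (cost_of conf) \<le> poly P (m * n) \<and>
           time (cost_of conf) \<le> poly P (m * n))"
proof (intro exI allI impI)
  let ?X = "[:0, 1:] :: nat poly"
  \<comment> \<open>The indeterminate stands for \<open>m * n\<close>, which bounds both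
    \<open>n\<close> and \<open>m\<close>; the power bounds the size of the basis.\<close>
  let ?P = "cost_bound ?X ?X ((?X + 1) ^ r)"
  fix n k m :: nat and Init \<delta> Bad I and F :: cnf and ts :: "state list"
  assume sys: "transition_system n Init \<delta> Bad"
    and inv: "inductive_invariant n Init \<delta> Bad I"
    and fenced: "forwards_fenced n Init \<delta> k I"
    and F: "cnf_over n F" "I = cnf_models n F" "length F = m" "almost_antimonotone r F"
    and ts_sparse: "distinct ts" "set ts = sparse_translations n r"
  interpret lambda_inference n k m Bad "\<delta>\<inverse>" Init ts "states n - I"
  proof
    show "inductive_invariant n Bad (\<delta>\<inverse>) Init (states n - I)"
      using inductive_invariant_dual sys inv by blast
    show "card {v. minimal_in (states n - I) a v} \<le> m" for a
      using card_minimal_in_cnf F by blast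
    show "set ts \<subseteq> states n" using ts_sparse(2) by (auto simp: sparse_translations_def)
    show "\<sigma> \<in> states n - I"
      if \<sigma>: "\<sigma> \<in> states n" "\<And>a. a \<in> set ts \<Longrightarrow> \<exists>v \<in> states n - I. below a v \<sigma>" for \<sigma>
    proof (rule ccontr)
      assume "\<sigma> \<notin> states n - I"
      \<comment> \<open>For this \<open>a\<close>, everything below \<open>\<sigma>\<close> lies in
        \<open>I\<close>, so \<open>\<sigma>\<close> is outside the hull of the complement at
        \<open>a\<close>.\<close>
      then obtain a where "a \<in> sparse_translations n r" "\<And>v. below a v \<sigma> \<Longrightarrow> v \<in> I"
        using exists_separating_translation[OF F(4,1), of \<sigma>] \<sigma>(1) F(2) by blast
      then show False using \<sigma>(2) ts_sparse(2) by blast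
    qed
  qed (rule fence_dual[OF fenced])
  note [simp] = dual_step_def
  have "inductive_invariant n Init \<delta> Bad (dual_result n Hs)"
    if "inductive_invariant n Bad (\<delta>\<inverse>) Init (conj_models n Hs)" for Hs
  proof -
    have "states n - dual_result n Hs = conj_models n Hs"
      by (auto simp: dual_result_def conj_models_def)
    then show ?thesis
      using that inductive_invariant_dual[OF sys, of "dual_result n Hs"] by (simp add: dual_result_def)
  qed
  then have "dual_converges n Init \<delta> Bad k ts"
    unfolding dual_converges_def using no_infinite_run final_config by auto metis+
  moreover have "cost_bound n m t \<le> poly ?P (m * n)"
  proof -
    \<comment> \<open>Positivity of both factors makes \<open>m * n\<close> dominate each: a single
      state cannot be split by a nontrivial \<open>Bad\<close>, and an empty CNF would leave
      \<open>Bad\<close> empty.\<close>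
    have "0 < n"
    proof (rule ccontr)
      assume "\<not> 0 < n"
      then have "states n = {[]}" by (auto simp: states_def)
      then show False using sys by (auto simp: transition_system_def)
    qed
    moreover have "0 < m"
    proof (rule ccontr)
      assume "\<not> 0 < m"
      then have "I = states n" using F by (simp add: cnf_models_def sat_cnf_def)
      then show False using sys inv by (auto simp: transition_system_def inductive_invariant_def)
    qed
    ultimately have le: "n \<le> m * n" "m \<le> m * n" by simp_all
    have "t \<le> (n + 1) ^ r"
      using card_sparse_translations[of n r] ts_sparse(2) distinct_card[OF ts_sparse(1)] by simp
    also have "\<dots> \<le> (m * n + 1) ^ r" using le by (intro power_mono) auto
    finally show ?thesis using le cost_bound_mono by (simp add: poly_cost_bound)
  qed
  ultimately show "dual_converges n Init \<delta> Bad k ts \<and>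
        (\<forall>conf. (dual_step n Init \<delta> Bad k ts)\<^sup>*\<^sup>* (lambda_start ts) conf \<longrightarrow>
           ind_checks (cost_of conf) \<le> poly ?P (m * n) \<and>
           bmc_checks (cost_of conf) \<le> poly ?P (m * n) \<and>
           time (cost_of conf) \<le> poly ?P (m * n))"
    unfolding dual_step_def by (meson reachable_cost le_trans)
qed

end
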